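(* There is an algorithm that, given as input a graph $G$ on $n$ vertices, together with integers $\ell$ and $h$ with $1 \leq \ell \leq h$ and a real $\delta$ with $0 \leq \delta \leq 1$, runs in polynomial time and outputs one of the following two objects: (1) a subgraph $G'$ of $G$ with $V(G') = V(G)$ such that every vertex of $G'$ has degree at most $h$ in $G'$, and fewer than $\delta \cdot n$ vertices of $G'$ have degree less than $\ell$ in $G'$; or (2) a partition of $V(G)$ into sets $L$, $H$, $R$ such that $|L| \geq \delta \cdot n$, every vertex in $L$ has strictly fewer than $\ell$ neighbors (in $G$) outside $H$, and $|H| \leq \frac{2\ell}{h}\cdot n$.
   Context: All graphs are finite and simple. *)

theory Defs
  imports
    Complex_Main
    "HOL-Computational_Algebra.Polynomial"
    "Graph_Theory.Pair_Digraph"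
    "Graph_Theory.Digraph_Component"
begin

text \<open>
  The machine model is a while language over a random access memory.  A store maps each name to an
  unbounded array of integers and to an unbounded array of exact reals (so that a real number can
  be an input); a scalar is cell 0 of an array.  A program mentions only finitely many names, and
  its constants are integers.

  Time is unit cost: every node of an expression that is evaluated and every command that is
  executed costs 1.  The operations on numbers are addition, subtraction and comparison
  only.  There is no multiplication, and no way from reals back to integers other than
  comparison, so the bit length of integers grows by at most a constant per unit of time and
  on integer and rational inputs polynomial unit-cost time is not stronger than polynomial time in
  the bit model.
\<close>

type_synonym vname = string

datatype iexp =
    Const int
  | Cell vname iexp
  | Plus iexp iexp
  | Minus iexp iexp

datatype rexp =
    OfInt iexp
  | RCell vname iexp
  | RPlus rexp rexp
  | RMinus rexp rexp

datatype bexp =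
    Less iexp iexp
  | RLess rexp rexp
  | Neg bexp
  | Conj bexp bexp

datatype com =
    Skip
  | Assign vname iexp iexp
  | RAssign vname iexp rexp
  | Seq com com
  | Cond bexp com com
  | While bexp com

record store =
  ints :: "vname \<Rightarrow> int \<Rightarrow> int"
  reals :: "vname \<Rightarrow> int \<Rightarrow> real"

primrec ival :: "iexp \<Rightarrow> store \<Rightarrow> int" where
  "ival (Const c) s = c"
| "ival (Cell x i) s = ints s x (ival i s)"
| "ival (Plus a b) s = ival a s + ival b s"
| "ival (Minus a b) s = ival a s - ival b s"

primrec rval :: "rexp \<Rightarrow> store \<Rightarrow> real" where
  "rval (OfInt a) s = real_of_int (ival a s)"
| "rval (RCell x i) s = reals s x (ival i s)"
| "rval (RPlus a b) s = rval a s + rval b s"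
| "rval (RMinus a b) s = rval a s - rval b s"

primrec bval :: "bexp \<Rightarrow> store \<Rightarrow> bool" where
  "bval (Less a b) s \<longleftrightarrow> ival a s < ival b s"
| "bval (RLess a b) s \<longleftrightarrow> rval a s < rval b s"
| "bval (Neg b) s \<longleftrightarrow> \<not> bval b s"
| "bval (Conj a b) s \<longleftrightarrow> bval a s \<and> bval b s"

primrec icost :: "iexp \<Rightarrow> nat" where
  "icost (Const c) = 1"
| "icost (Cell x i) = 1 + icost i"
| "icost (Plus a b) = 1 + icost a + icost b"
| "icost (Minus a b) = 1 + icost a + icost b"

primrec rcost :: "rexp \<Rightarrow> nat" where
  "rcost (OfInt a) = 1 + icost a"
| "rcost (RCell x i) = 1 + icost i"
| "rcost (RPlus a b) = 1 + rcost a + rcost b"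
| "rcost (RMinus a b) = 1 + rcost a + rcost b"

primrec bcost :: "bexp \<Rightarrow> nat" where
  "bcost (Less a b) = 1 + icost a + icost b"
| "bcost (RLess a b) = 1 + rcost a + rcost b"
| "bcost (Neg b) = 1 + bcost b"
| "bcost (Conj a b) = 1 + bcost a + bcost b"

definition upd :: "(vname \<Rightarrow> int \<Rightarrow> 'v) \<Rightarrow> vname \<Rightarrow> int \<Rightarrow> 'v \<Rightarrow> vname \<Rightarrow> int \<Rightarrow> 'v" where
  "upd m x i v = m(x := (m x)(i := v))"

text \<open>\<open>exec c s t s'\<close>: started in \<open>s\<close>, the command \<open>c\<close> halts after time \<open>t\<close> in \<open>s'\<close>.\<close>

inductive exec :: "com \<Rightarrow> store \<Rightarrow> nat \<Rightarrow> store \<Rightarrow> bool" where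
  Skip: "exec Skip s 1 s"
| Assign: "exec (Assign x i e) s (1 + icost i + icost e)
    (s\<lparr>ints := upd (ints s) x (ival i s) (ival e s)\<rparr>)"
| RAssign: "exec (RAssign x i e) s (1 + icost i + rcost e)
    (s\<lparr>reals := upd (reals s) x (ival i s) (rval e s)\<rparr>)"
| Seq: "exec c1 s t1 s1 \<Longrightarrow> exec c2 s1 t2 s2 \<Longrightarrow> exec (Seq c1 c2) s (1 + t1 + t2) s2"
| CondTrue: "bval b s \<Longrightarrow> exec c1 s t s' \<Longrightarrow> exec (Cond b c1 c2) s (1 + bcost b + t) s'"
| CondFalse: "\<not> bval b s \<Longrightarrow> exec c2 s t s' \<Longrightarrow> exec (Cond b c1 c2) s (1 + bcost b + t) s'"
| WhileFalse: "\<not> bval b s \<Longrightarrow> exec (While b c) s (1 + bcost b) s"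
| WhileTrue: "bval b s \<Longrightarrow> exec c s t1 s1 \<Longrightarrow> exec (While b c) s1 t2 s2
    \<Longrightarrow> exec (While b c) s (1 + bcost b + t1 + t2) s2"

inductive_cases exec_SkipE: "exec Skip s t s'"
inductive_cases exec_AssignE: "exec (Assign x i e) s t s'"
inductive_cases exec_RAssignE: "exec (RAssign x i e) s t s'"
inductive_cases exec_SeqE: "exec (Seq c1 c2) s t s'"
inductive_cases exec_CondE: "exec (Cond b c1 c2) s t s'"
inductive_cases exec_WhileE: "exec (While b c) s t s'"

lemma exec_deterministic:
  "exec c s t s' \<Longrightarrow> exec c s u s'' \<Longrightarrow> t = u \<and> s' = s''"
proof (induction arbitrary: u s'' rule: exec.induct)
  case (Skip s)
  from Skip.prems show ?case by (rule exec_SkipE) simp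
next
  case (Assign x i e s)
  from Assign.prems show ?case by (rule exec_AssignE) simp
next
  case (RAssign x i e s)
  from RAssign.prems show ?case by (rule exec_RAssignE) simp
next
  case (Seq c1 s t1 s1 c2 t2 s2)
  from Seq.prems show ?case by (rule exec_SeqE) (use Seq.IH in \<open>metis plus_1_eq_Suc add_Suc\<close>)
next
  case (CondTrue b s c1 t s' c2)
  from CondTrue.prems show ?case by (rule exec_CondE) (use CondTrue.hyps CondTrue.IH in \<open>metis plus_1_eq_Suc add_Suc\<close>)+
next
  case (CondFalse b s c2 t s' c1)
  from CondFalse.prems show ?case by (rule exec_CondE) (use CondFalse.hyps CondFalse.IH in \<open>metis plus_1_eq_Suc add_Suc\<close>)+
next
  case (WhileFalse b s c)
  from WhileFalse.prems show ?case by (rule exec_WhileE) (use WhileFalse.hyps in simp_all)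
next
  case (WhileTrue b s c t1 s1 t2 s2)
  from WhileTrue.prems show ?case by (rule exec_WhileE) (use WhileTrue.hyps WhileTrue.IH in \<open>metis plus_1_eq_Suc add_Suc\<close>)+
qed

text \<open>
  A finite simple graph is a \<open>pair_graph\<close>: an edge \<open>uv\<close> is the pair of arcs \<open>(u, v)\<close>, \<open>(v, u)\<close>,
  so that \<open>out_degree\<close> is the degree.  Graphs handed to a program have the vertices
  \<open>0, \<dots>, n - 1\<close> and are given by the adjacency matrix, stored row by row.
\<close>

definition adj_matrix :: "nat \<Rightarrow> nat pair_pre_digraph \<Rightarrow> int \<Rightarrow> int" where
  "adj_matrix n G k =
    (if \<exists>i<n. \<exists>j<n. k = int (i * n + j) \<and> (i, j) \<in> parcs G then 1 else 0)"

definition input_store :: "nat \<Rightarrow> nat pair_pre_digraph \<Rightarrow> int \<Rightarrow> int \<Rightarrow> real \<Rightarrow> store" where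
  "input_store n G l h \<delta> = \<lparr>
     ints = (\<lambda>_ _. 0)(
       ''n'' := (\<lambda>_. 0)(0 := int n),
       ''l'' := (\<lambda>_. 0)(0 := l),
       ''h'' := (\<lambda>_. 0)(0 := h),
       ''graph'' := adj_matrix n G),
     reals = (\<lambda>_ _. 0)(''delta'' := (\<lambda>_. 0)(0 := \<delta>)) \<rparr>"

text \<open>The number of memory cells occupied by the input.\<close>

definition input_size :: "nat \<Rightarrow> nat" where
  "input_size n = n * n + 4"

text \<open>The integer \<open>''kind''\<close> tells which of the two kinds of object a program outputs.\<close>

definition outputs_graph :: "store \<Rightarrow> nat \<Rightarrow> nat pair_pre_digraph \<Rightarrow> bool" where
  "outputs_graph s n G' \<longleftrightarrow>
     ints s ''kind'' 0 = 1 \<and> (\<forall>k<n * n. ints s ''out'' (int k) = adj_matrix n G' (int k))"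

definition outputs_partition :: "store \<Rightarrow> nat \<Rightarrow> nat set \<Rightarrow> nat set \<Rightarrow> nat set \<Rightarrow> bool" where
  "outputs_partition s n L H R \<longleftrightarrow>
     ints s ''kind'' 0 = 2 \<and>
     (\<forall>v<n. (v \<in> L \<longleftrightarrow> ints s ''out'' (int v) = 1) \<and>
            (v \<in> H \<longleftrightarrow> ints s ''out'' (int v) = 2) \<and>
            (v \<in> R \<longleftrightarrow> ints s ''out'' (int v) = 3))"

definition degree_bounded_subgraph ::
  "nat pair_pre_digraph \<Rightarrow> int \<Rightarrow> int \<Rightarrow> real \<Rightarrow> nat pair_pre_digraph \<Rightarrow> bool" where
  "degree_bounded_subgraph G l h \<delta> G' \<longleftrightarrow>
     pair_graph G' \<and> spanning (with_proj G') (with_proj G) \<and>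
     (\<forall>v\<in>pverts G'. int (out_degree (with_proj G') v) \<le> h) \<and>
     real (card {v \<in> pverts G'. int (out_degree (with_proj G') v) < l})
       < \<delta> * real (card (pverts G))"

definition low_degree_partition ::
  "nat pair_pre_digraph \<Rightarrow> int \<Rightarrow> int \<Rightarrow> real \<Rightarrow> nat set \<Rightarrow> nat set \<Rightarrow> nat set \<Rightarrow> bool" where
  "low_degree_partition G l h \<delta> L H R \<longleftrightarrow>
     L \<union> H \<union> R = pverts G \<and> L \<inter> H = {} \<and> L \<inter> R = {} \<and> H \<inter> R = {} \<and>
     real (card L) \<ge> \<delta> * real (card (pverts G)) \<and>
     (\<forall>v\<in>L. int (card {w \<in> pverts G - H. (v, w) \<in> parcs G}) < l) \<and>
     real (card H) \<le> 2 * real_of_int l / real_of_int h * real (card (pverts G))"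

end

theory Submission
  imports Defs
begin

text \<open>
  Scan all ordered pairs \<open>(u, v)\<close> once, and add an edge \<open>uv\<close> of the graph to the (initially empty)
  subgraph whenever at that moment \<open>u\<close> has degree less than \<open>l\<close> and \<open>v\<close> has degree less than \<open>h\<close>.
  Degrees only grow, so a rejected pair stays unsuitable: in the end every neighbour of a vertex of
  degree less than \<open>l\<close> is joined to it in the subgraph or has degree \<open>h\<close>. Every added edge raises
  \<open>\<Sum>v. min (deg v) l\<close>, so at most \<open>l * n\<close> edges are added, the degrees sum up to at most
  \<open>2 * l * n\<close>, and at most \<open>2 * l * n / h\<close> vertices have degree \<open>h\<close>.
  If at least \<open>\<delta> * n\<close> vertices have degree less than \<open>l\<close>, they are \<open>L\<close> and the vertices of degree
  \<open>h\<close> are \<open>H\<close>; otherwise the subgraph itself is output.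
\<close>

section \<open>The greedy subgraph\<close>

text \<open>Degrees belong to a bare arc set, so intermediate stages need not be shown to be
  graphs.\<close>

definition deg :: "('a \<times> 'a) set \<Rightarrow> 'a \<Rightarrow> int" where
  "deg E v = int (card (E `` {v}))"

text \<open>The test is one-sided: \<open>u\<close> must still want edges, \<open>v\<close> must
  still have room. Both orders of an edge get scanned, so either endpoint can play the part of
  \<open>u\<close>.\<close>

definition add_edge :: "('a \<times> 'a) set \<Rightarrow> int \<Rightarrow> int \<Rightarrow> 'a \<times> 'a \<Rightarrow> ('a \<times> 'a) set \<Rightarrow> ('a \<times> 'a) set" where
  "add_edge A l h = (\<lambda>(u, v) E.
     if (u, v) \<in> A \<and> (u, v) \<notin> E \<and> deg E u < l \<and> deg E v < h
     then insert (u, v) (insert (v, u) E) else E)"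

text \<open>\<open>P\<close> is the set of pairs scanned so far. The degree sum is twice the number
  of edges, so the fourth conjunct bounds that number by the potential
  \<open>\<Sum>v\<in>pverts G. min (deg E v) l\<close>.\<close>

definition greedy_invariant ::
  "'a pair_pre_digraph \<Rightarrow> int \<Rightarrow> int \<Rightarrow> ('a \<times> 'a) set \<Rightarrow> ('a \<times> 'a) set \<Rightarrow> bool" where
  "greedy_invariant G l h P E \<longleftrightarrow>
     E \<subseteq> parcs G \<and> sym E \<and> (\<forall>v. deg E v \<le> h) \<and>
     (\<Sum>v\<in>pverts G. deg E v) \<le> 2 * (\<Sum>v\<in>pverts G. min (deg E v) l) \<and>
     (\<forall>(u, v) \<in> P \<inter> parcs G. (u, v) \<in> E \<or> l \<le> deg E u \<or> h \<le> deg E v)"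

lemma deg_insert_edge:
  assumes "finite E" "sym E" "(u, v) \<notin> E" "u \<noteq> v"
  shows "deg (insert (u, v) (insert (v, u) E)) x = deg E x + of_bool (x = u \<or> x = v)"
proof -
  have fin: "finite (E `` {x})" for x
    using assms(1) by (rule finite_Image)
  have "(v, u) \<notin> E"
    using assms(2,3) by (auto dest: symD)
  moreover have "insert (u, v) (insert (v, u) E) `` {x} =
      (if x = u then insert v (E `` {u}) else if x = v then insert u (E `` {v}) else E `` {x})"
    using assms(4) by auto
  ultimately show ?thesis
    using assms fin by (auto simp: deg_def)
qed

lemma greedy_invariant_empty: "0 \<le> l \<Longrightarrow> 0 \<le> h \<Longrightarrow> greedy_invariant G l h {} {}"
  by (auto simp: greedy_invariant_def deg_def sym_def)

lemma greedy_invariant_add_edge: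
  assumes G: "pair_graph G" and "l \<le> h" and inv: "greedy_invariant G l h P E"
  shows "greedy_invariant G l h (insert e P) (add_edge (parcs G) l h e E)"
proof -
  obtain u v where e: "e = (u, v)" by (cases e)
  interpret pair_graph G by (rule G)
  show ?thesis
  proof (cases "(u, v) \<in> parcs G \<and> (u, v) \<notin> E \<and> deg E u < l \<and> deg E v < h")
    case False
    then show ?thesis
      using inv by (auto simp: e add_edge_def greedy_invariant_def)
  next
    case True
    let ?E = "insert (u, v) (insert (v, u) E)"
    have E: "E \<subseteq> parcs G" "sym E" "\<And>x. deg E x \<le> h"
      "(\<Sum>x\<in>pverts G. deg E x) \<le> 2 * (\<Sum>x\<in>pverts G. min (deg E x) l)"
      and scanned: "\<And>x y. (x, y) \<in> P \<Longrightarrow> (x, y) \<in> parcs G \<Longrightarrow>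
        (x, y) \<in> E \<or> l \<le> deg E x \<or> h \<le> deg E y"
      using inv by (auto simp: greedy_invariant_def)
    have uv: "u \<noteq> v" "u \<in> pverts G" "v \<in> pverts G"
      using True no_loops' arc_fst_in_verts arc_snd_in_verts by force+
    have "finite E"
      using E(1) pair_finite_arcs by (rule finite_subset)
    then have deg: "deg ?E x = deg E x + of_bool (x = u \<or> x = v)" for x
      using E(2) True uv(1) by (intro deg_insert_edge) auto
    \<comment> \<open>The degree sum grows by exactly 2. The potential grows by at least 1, since
      \<open>deg E u < l\<close>, which matches the factor 2 in the invariant.\<close>
    have "(\<Sum>x\<in>pverts G. deg ?E x) = (\<Sum>x\<in>pverts G. deg E x) + 2"
    proof -
      have "pverts G \<inter> {x. x = u \<or> x = v} = {u, v}"
        using uv by auto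
      then show ?thesis
        using uv(1) pair_finite_verts by (simp add: deg sum.distrib of_bool_def sum.If_cases)
    qed
    moreover have "(\<Sum>x\<in>pverts G. min (deg E x) l) < (\<Sum>x\<in>pverts G. min (deg ?E x) l)"
      using uv True pair_finite_verts
      by (intro sum_strict_mono_ex1) (auto simp: deg intro!: bexI[of _ u])
    moreover have "?E \<subseteq> parcs G"
      using E(1) True arcs_symmetric by auto
    moreover have "sym ?E"
      using E(2) by (auto simp: sym_def)
    \<comment> \<open>The test keeps \<open>v\<close> below \<open>h\<close> but \<open>u\<close>
      only below \<open>l\<close>; \<open>l \<le> h\<close> gives \<open>u\<close> room as
      well.\<close>
    moreover have "deg ?E x \<le> h" for x
      using E(3)[of x] True \<open>l \<le> h\<close> by (auto simp: deg)
    moreover have "(x, y) \<in> ?E \<or> l \<le> deg ?E x \<or> h \<le> deg ?E y"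
      if "(x, y) \<in> insert (u, v) P" "(x, y) \<in> parcs G" for x y
      using that scanned[of x y] by (auto simp: deg)
    ultimately show ?thesis
      using True E(4) by (auto simp: e add_edge_def greedy_invariant_def)
  qed
qed

section \<open>What the invariant yields for the two outputs\<close>

text \<open>Double counting: each saturated vertex contributes \<open>h\<close> to the degree sum,
  and each vertex contributes at most \<open>l\<close> to the potential.\<close>

lemma card_saturated_le:
  assumes "finite (pverts G)" "0 < h" and inv: "greedy_invariant G l h P E"
  shows "real (card {v \<in> pverts G. deg E v = h}) \<le> 2 * of_int l / of_int h * real (card (pverts G))"
proof -
  let ?H = "{v \<in> pverts G. deg E v = h}"
  have "int (card ?H) * h = (\<Sum>v\<in>?H. deg E v)"
    by simp
  also have "\<dots> \<le> (\<Sum>v\<in>pverts G. deg E v)"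
    using assms(1) by (intro sum_mono2) (auto simp: deg_def)
  also have "\<dots> \<le> 2 * (\<Sum>v\<in>pverts G. min (deg E v) l)"
    using inv by (simp add: greedy_invariant_def)
  also have "\<dots> \<le> 2 * (\<Sum>v\<in>pverts G. l)"
    by (intro mult_left_mono sum_mono) auto
  finally have "int (card ?H) * h \<le> 2 * l * int (card (pverts G))"
    by (simp add: mult_ac)
  then have "real_of_int (int (card ?H) * h) \<le> real_of_int (2 * l * int (card (pverts G)))"
    by (simp only: of_int_le_iff)
  then show ?thesis
    using assms(2) by (simp add: field_simps)
qed

text \<open>Once all arcs are scanned, a neighbour of \<open>v\<close> outside the saturated set can
  only satisfy the first disjunct of the invariant, so it is already counted in
  \<open>deg E v\<close>.\<close>

lemma card_unsaturated_neighbours_le: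
  assumes G: "pair_graph G" and inv: "greedy_invariant G l h P E" and "parcs G \<subseteq> P" "deg E v < l"
  shows "int (card {w \<in> pverts G - {w \<in> pverts G. deg E w = h}. (v, w) \<in> parcs G}) < l"
proof -
  interpret pair_graph G by (rule G)
  have "E \<subseteq> parcs G"
    using inv by (simp add: greedy_invariant_def)
  then have "finite E"
    using pair_finite_arcs by (rule finite_subset)
  moreover have "(v, w) \<in> E"
    if "(v, w) \<in> parcs G" "deg E w \<noteq> h" for w
  proof -
    have "deg E w \<le> h" "(v, w) \<in> E \<or> l \<le> deg E v \<or> h \<le> deg E w"
      using inv that(1) \<open>parcs G \<subseteq> P\<close> unfolding greedy_invariant_def by blast+
    then show ?thesis
      using that(2) \<open>deg E v < l\<close> by auto
  qed
  ultimately have "card {w \<in> pverts G - {w \<in> pverts G. deg E w = h}. (v, w) \<in> parcs G}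
      \<le> card (E `` {v})"
    by (intro card_mono finite_Image) auto
  then show ?thesis
    using \<open>deg E v < l\<close> by (simp add: deg_def)
qed

text \<open>The three sets cover the vertices because no degree exceeds \<open>h\<close>; the first
  two are disjoint because \<open>l \<le> h\<close>.\<close>

lemma low_degree_partition_greedy:
  assumes G: "pair_graph G" and "1 \<le> l" "l \<le> h"
    and inv: "greedy_invariant G l h P E" and "parcs G \<subseteq> P"
    and "\<delta> * real (card (pverts G)) \<le> real (card {v \<in> pverts G. deg E v < l})"
  shows "low_degree_partition G l h \<delta> {v \<in> pverts G. deg E v < l}
    {v \<in> pverts G. deg E v = h} {v \<in> pverts G. l \<le> deg E v \<and> deg E v < h}"
proof -
  interpret pair_graph G by (rule G)
  have "deg E v \<le> h" for v
    using inv by (simp add: greedy_invariant_def)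
  then show ?thesis
    unfolding low_degree_partition_def
    using assms card_saturated_le[OF pair_finite_verts _ inv] card_unsaturated_neighbours_le[OF G inv]
    by (auto simp: order_less_le linorder_not_less)
qed

lemma out_degree_eq_deg: "int (out_degree (with_proj \<lparr>pverts = V, parcs = E\<rparr>) v) = deg E v"
proof -
  have "out_arcs (with_proj \<lparr>pverts = V, parcs = E\<rparr>) v = Pair v ` (E `` {v})"
    by (auto simp: out_arcs_def)
  then show ?thesis
    by (simp add: out_degree_def deg_def card_image inj_on_def)
qed

lemma degree_bounded_subgraph_greedy:
  assumes G: "pair_graph G" and inv: "greedy_invariant G l h P E"
    and "real (card {v \<in> pverts G. deg E v < l}) < \<delta> * real (card (pverts G))"
  shows "degree_bounded_subgraph G l h \<delta> \<lparr>pverts = pverts G, parcs = E\<rparr>"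
proof -
  interpret pair_graph G by (rule G)
  have E: "E \<subseteq> parcs G" "sym E" "\<And>v. deg E v \<le> h"
    using inv by (auto simp: greedy_invariant_def)
  \<comment> \<open>Symmetry comes from the invariant; the other graph axioms are inherited from
    \<open>G\<close> along \<open>E \<subseteq> parcs G\<close>.\<close>
  have "pair_graph \<lparr>pverts = pverts G, parcs = E\<rparr>"
    using E pair_finite_verts finite_subset[OF E(1) pair_finite_arcs]
      subsetD[OF E(1), THEN arc_fst_in_verts] subsetD[OF E(1), THEN arc_snd_in_verts]
      subsetD[OF E(1), THEN pair_no_loops]
    by unfold_locales (simp_all add: symmetric_def arcs_ends_def arc_to_ends_def)
  then have "pair_graph \<lparr>pverts = pverts G, parcs = E\<rparr>"
    and "wf_digraph (with_proj \<lparr>pverts = pverts G, parcs = E\<rparr>)"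
    by (auto simp: wf_digraph_wp_iff pair_graph_def pair_digraph_def pair_fin_digraph_def)
  then show ?thesis
    unfolding degree_bounded_subgraph_def spanning_def subgraph_def out_degree_eq_deg
    using E assms(3) wf_digraph_axioms by (auto simp: compatible_def)
qed

section \<open>The scan in row-by-row order of the adjacency matrix\<close>

text \<open>The \<open>k\<close>-th pair scanned is the one at cell \<open>k\<close> of the matrix,
  so a single counter drives the scan.\<close>

fun greedy :: "nat pair_pre_digraph \<Rightarrow> int \<Rightarrow> int \<Rightarrow> nat \<Rightarrow> nat \<Rightarrow> (nat \<times> nat) set" where
  "greedy G l h n 0 = {}"
| "greedy G l h n (Suc k) = add_edge (parcs G) l h (k div n, k mod n) (greedy G l h n k)"

lemma greedy_invariant_greedy:
  assumes "pair_graph G" "1 \<le> l" "l \<le> h"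
  shows "greedy_invariant G l h ((\<lambda>k. (k div n, k mod n)) ` {..<k}) (greedy G l h n k)"
  using assms by (induction k)
    (auto simp: greedy_invariant_empty lessThan_Suc intro!: greedy_invariant_add_edge)

lemma matrix_index_less: "(i::nat) < n \<Longrightarrow> j < n \<Longrightarrow> i * n + j < n * n"
proof -
  assume "i < n" "j < n"
  then have "i * n + j < Suc i * n" by simp
  also have "\<dots> \<le> n * n" using \<open>i < n\<close> by (intro mult_le_mono1) simp
  finally show ?thesis .
qed

lemma matrix_index_inject:
  fixes i :: nat
  assumes "j < n" "j' < n"
  shows "i * n + j = i' * n + j' \<longleftrightarrow> i = i' \<and> j = j'"
proof
  assume eq: "i * n + j = i' * n + j'"
  have "(i * n + j) div n = (i' * n + j') div n" "(i * n + j) mod n = (i' * n + j') mod n"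
    by (simp_all only: eq)
  then show "i = i' \<and> j = j'" using assms by simp
qed simp

text \<open>Supplies the premise \<open>parcs G \<subseteq> P\<close> for the complete scan of
  \<open>n * n\<close> pairs.\<close>

lemma parcs_subset_matrix_indices:
  fixes n :: nat
  assumes "pair_graph G" "pverts G = {..<n}"
  shows "parcs G \<subseteq> (\<lambda>k. (k div n, k mod n)) ` {..<n * n}"
proof
  interpret pair_graph G by fact
  fix e assume "e \<in> parcs G"
  then have e: "fst e < n" "snd e < n"
    using arc_fst_in_verts arc_snd_in_verts assms(2) by auto
  show "e \<in> (\<lambda>k. (k div n, k mod n)) ` {..<n * n}"
    by (rule image_eqI[of _ _ "fst e * n + snd e"])
      (use e in \<open>auto simp: matrix_index_less prod_eq_iff\<close>)
qed

text \<open>The existential in \<open>adj_matrix\<close> collapses because a cell number determines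
  its row and column.\<close>

lemma adj_matrix_eq:
  assumes "i < n" "j < n"
  shows "adj_matrix n G (int (i * n + j)) = of_bool ((i, j) \<in> parcs G)"
proof -
  have "(\<exists>i'<n. \<exists>j'<n. i * n + j = i' * n + j' \<and> (i', j') \<in> parcs G) \<longleftrightarrow> (i, j) \<in> parcs G"
    using assms matrix_index_inject[OF assms(2)] by metis
  then show ?thesis
    unfolding adj_matrix_def of_nat_eq_iff by simp
qed

section \<open>Programs with time bounds\<close>

text \<open>A total-correctness judgement: termination is included, and \<open>T\<close> is only an
  upper bound on the time.\<close>

definition runs :: "com \<Rightarrow> store \<Rightarrow> nat \<Rightarrow> (store \<Rightarrow> bool) \<Rightarrow> bool" where
  "runs c s T Q \<longleftrightarrow> (\<exists>t s'. exec c s t s' \<and> t \<le> T \<and> Q s')"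

primrec loop_free :: "com \<Rightarrow> bool" where
  "loop_free Skip \<longleftrightarrow> True"
| "loop_free (Assign x i e) \<longleftrightarrow> True"
| "loop_free (RAssign x i e) \<longleftrightarrow> True"
| "loop_free (Seq c d) \<longleftrightarrow> loop_free c \<and> loop_free d"
| "loop_free (Cond b c d) \<longleftrightarrow> loop_free c \<and> loop_free d"
| "loop_free (While b c) \<longleftrightarrow> False"

text \<open>The values of \<open>result\<close> and \<open>cost\<close> at a loop are junk.\<close>

primrec result :: "com \<Rightarrow> store \<Rightarrow> store" where
  "result Skip s = s"
| "result (Assign x i e) s = s\<lparr>ints := upd (ints s) x (ival i s) (ival e s)\<rparr>"
| "result (RAssign x i e) s = s\<lparr>reals := upd (reals s) x (ival i s) (rval e s)\<rparr>"
| "result (Seq c d) s = result d (result c s)"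
| "result (Cond b c d) s = (if bval b s then result c s else result d s)"
| "result (While b c) s = s"

primrec cost :: "com \<Rightarrow> nat" where
  "cost Skip = 1"
| "cost (Assign x i e) = 1 + icost i + icost e"
| "cost (RAssign x i e) = 1 + icost i + rcost e"
| "cost (Seq c d) = 1 + cost c + cost d"
| "cost (Cond b c d) = 1 + bcost b + max (cost c) (cost d)"
| "cost (While b c) = 0"

text \<open>The time is only bounded above: \<open>cost\<close> charges the dearer branch of each
  conditional and so does not depend on the store.\<close>

lemma exec_loop_free:
  "loop_free c \<Longrightarrow> \<exists>t \<le> cost c. exec c s t (result c s)"
proof (induction c arbitrary: s)
  case (Seq c d)
  then obtain t u where "t \<le> cost c" "exec c s t (result c s)"
    "u \<le> cost d" "exec d (result c s) u (result d (result c s))"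
    by (metis loop_free.simps(4))
  then show ?case
    using exec.Seq by (intro exI[of _ "1 + t + u"]) auto
next
  case (Cond b c d)
  show ?case
  proof (cases "bval b s")
    case True
    with Cond obtain t where "t \<le> cost c" "exec c s t (result c s)" by auto
    with True show ?thesis
      using exec.CondTrue by (intro exI[of _ "1 + bcost b + t"]) auto
  next
    case False
    with Cond obtain t where "t \<le> cost d" "exec d s t (result d s)" by auto
    with False show ?thesis
      using exec.CondFalse by (intro exI[of _ "1 + bcost b + t"]) auto
  qed
next
  case Skip
  show ?case using exec.Skip[of s] by auto
next
  case (Assign x i e)
  show ?case using exec.Assign[of x i e s] by auto
next
  case (RAssign x i e)
  show ?case using exec.RAssign[of x i e s] by auto
qed simp

lemma runs_loop_free: "loop_free c \<Longrightarrow> Q (result c s) \<Longrightarrow> runs c s (cost c) Q"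
  using exec_loop_free unfolding runs_def by blast

lemma runs_Seq:
  assumes "runs c s T P" "\<And>s. P s \<Longrightarrow> runs d s U Q"
  shows "runs (Seq c d) s (1 + T + U) Q"
proof -
  obtain t s' where "exec c s t s'" "t \<le> T" "P s'"
    using assms(1) unfolding runs_def by blast
  moreover obtain u s'' where "exec d s' u s''" "u \<le> U" "Q s''"
    using assms(2)[OF \<open>P s'\<close>] unfolding runs_def by blast
  ultimately show ?thesis
    unfolding runs_def
    by (intro exI[of _ "1 + t + u"] exI[of _ s''] conjI exec.Seq) auto
qed

lemma runs_Cond:
  assumes "bval b s \<Longrightarrow> runs c s T Q" "\<not> bval b s \<Longrightarrow> runs d s T Q"
  shows "runs (Cond b c d) s (1 + bcost b + T) Q"
proof (cases "bval b s")
  case True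
  then obtain t s' where "exec c s t s'" "t \<le> T" "Q s'"
    using assms(1) unfolding runs_def by blast
  then show ?thesis
    using True unfolding runs_def
    by (intro exI[of _ "1 + bcost b + t"] exI[of _ s'] conjI exec.CondTrue) auto
next
  case False
  then obtain t s' where "exec d s t s'" "t \<le> T" "Q s'"
    using assms(2) unfolding runs_def by blast
  then show ?thesis
    using False unfolding runs_def
    by (intro exI[of _ "1 + bcost b + t"] exI[of _ s'] conjI exec.CondFalse) auto
qed

lemma runs_mono: "runs c s T P \<Longrightarrow> T \<le> U \<Longrightarrow> (\<And>s. P s \<Longrightarrow> Q s) \<Longrightarrow> runs c s U Q"
  unfolding runs_def by (meson order_trans)

text \<open>The invariant is indexed by the number of completed iterations. There are
  \<open>N\<close> bodies but \<open>N + 1\<close> guard tests, whence \<open>Suc N\<close>.\<close>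

lemma runs_While:
  assumes "loop_free c" "I 0 s"
    and step: "\<And>k s. k < N \<Longrightarrow> I k s \<Longrightarrow> bval b s \<and> I (Suc k) (result c s)"
    and exit: "\<And>s. I N s \<Longrightarrow> \<not> bval b s"
  shows "runs (While b c) s ((1 + bcost b + cost c) * Suc N) (I N)"
proof -
  \<comment> \<open>Generalised to a start after \<open>k\<close> iterations, for induction on the
    number \<open>m\<close> of those remaining.\<close>
  have "runs (While b c) s ((1 + bcost b + cost c) * Suc m) (I N)" if "k + m = N" "I k s" for k m s
    using that
  proof (induction m arbitrary: k s)
    case 0
    then show ?case
      unfolding runs_def using exit[of s]
      by (intro exI[of _ "1 + bcost b"] exI[of _ s] conjI exec.WhileFalse) auto
  next
    case (Suc m)
    from step[of k s] Suc.prems have b: "bval b s" "I (Suc k) (result c s)" by auto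
    obtain t where t: "t \<le> cost c" "exec c s t (result c s)"
      using exec_loop_free[OF \<open>loop_free c\<close>] by blast
    obtain u s' where "exec (While b c) (result c s) u s'" "I N s'"
      "u \<le> (1 + bcost b + cost c) * Suc m"
      using Suc.IH[of "Suc k" "result c s"] Suc.prems(1) b(2) unfolding runs_def by auto
    with b(1) t show ?case
      unfolding runs_def
      by (intro exI[of _ "1 + bcost b + t + u"] exI[of _ s'] conjI exec.WhileTrue) auto
  qed
  from this[of 0 N s] show ?thesis
    using assms(2) by simp
qed

section \<open>The algorithm\<close>

abbreviation scalar :: "vname \<Rightarrow> iexp" where
  "scalar x \<equiv> Cell x (Const 0)"

abbreviation set_scalar :: "vname \<Rightarrow> iexp \<Rightarrow> com" where
  "set_scalar x e \<equiv> Assign x (Const 0) e"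

abbreviation increment :: "vname \<Rightarrow> iexp \<Rightarrow> com" where
  "increment x i \<equiv> Assign x i (Plus (Cell x i) (Const 1))"

text \<open>
  The pair \<open>(i, j)\<close> is scanned at time \<open>k = i * n + j\<close>. In the absence of multiplication the index
  \<open>j * n + i\<close> of the transposed pair is kept up to date in \<open>''t''\<close>.
\<close>

definition scan_pair :: com where
  "scan_pair =
     Cond
       (Conj (Less (Const 0) (Cell ''graph'' (scalar ''k'')))
        (Conj (Less (Cell ''out'' (scalar ''k'')) (Const 1))
         (Conj (Less (Cell ''deg'' (scalar ''i'')) (scalar ''l''))
          (Less (Cell ''deg'' (scalar ''j'')) (scalar ''h'')))))
       (Seq (Assign ''out'' (scalar ''k'') (Const 1))
        (Seq (Assign ''out'' (scalar ''t'') (Const 1))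
         (Seq (increment ''deg'' (scalar ''i''))
          (increment ''deg'' (scalar ''j'')))))
       Skip"

text \<open>A step along a row adds \<open>n\<close> to the transposed index
  \<open>j * n + i\<close>; at the start of a row that index is \<open>0 * n + i\<close>, hence the
  copy of \<open>''i''\<close>.\<close>

definition next_pair :: com where
  "next_pair =
     Seq (increment ''k'' (Const 0))
     (Seq (increment ''j'' (Const 0))
      (Cond (Less (scalar ''j'') (scalar ''n''))
        (set_scalar ''t'' (Plus (scalar ''t'') (scalar ''n'')))
        (Seq (increment ''i'' (Const 0))
         (Seq (set_scalar ''j'' (Const 0))
          (set_scalar ''t'' (scalar ''i''))))))"

definition scan_body :: com where
  "scan_body = Seq scan_pair next_pair"

text \<open>The threshold \<open>\<delta> * n\<close> is built by repeated addition, one summand per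
  vertex, for lack of multiplication.\<close>

definition count_body :: com where
  "count_body =
     Seq (RAssign ''bound'' (Const 0) (RPlus (RCell ''bound'' (Const 0)) (RCell ''delta'' (Const 0))))
     (Seq (Cond (Less (Cell ''deg'' (scalar ''v'')) (scalar ''l'')) (increment ''count'' (Const 0)) Skip)
      (increment ''v'' (Const 0)))"

text \<open>The labels overwrite matrix cells in \<open>''out''\<close>, which is safe because only
  \<open>''deg''\<close> and scalars are read here.\<close>

definition label_body :: com where
  "label_body =
     Seq (Cond (Less (Cell ''deg'' (scalar ''v'')) (scalar ''l''))
       (Assign ''out'' (scalar ''v'') (Const 1))
       (Cond (Less (Cell ''deg'' (scalar ''v'')) (scalar ''h''))
         (Assign ''out'' (scalar ''v'') (Const 3))
         (Assign ''out'' (scalar ''v'') (Const 2))))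
     (increment ''v'' (Const 0))"

definition for_all_vertices :: "com \<Rightarrow> com" where
  "for_all_vertices c = While (Less (scalar ''v'') (scalar ''n'')) c"

text \<open>The counters rely on all cells outside the input being 0 initially; only
  \<open>''v''\<close> is used by two loops and must be reset.\<close>

definition algorithm :: com where
  "algorithm =
     Seq (While (Less (scalar ''i'') (scalar ''n'')) scan_body)
     (Seq (for_all_vertices count_body)
      (Cond (RLess (OfInt (scalar ''count'')) (RCell ''bound'' (Const 0)))
        (set_scalar ''kind'' (Const 1))
        (Seq (Seq (set_scalar ''kind'' (Const 2)) (set_scalar ''v'' (Const 0)))
         (for_all_vertices label_body))))"

section \<open>Loop invariants and their preservation\<close>

text \<open>The zero values of \<open>''v''\<close>, \<open>''count''\<close> and
  \<open>''bound''\<close> are carried along for the counting loop.\<close>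

definition scan_invariant ::
  "nat \<Rightarrow> nat pair_pre_digraph \<Rightarrow> int \<Rightarrow> int \<Rightarrow> real \<Rightarrow> nat \<Rightarrow> store \<Rightarrow> bool" where
  "scan_invariant n G l h \<delta> k s \<longleftrightarrow>
     ints s ''n'' 0 = int n \<and> ints s ''l'' 0 = l \<and> ints s ''h'' 0 = h \<and>
     ints s ''graph'' = adj_matrix n G \<and> reals s ''delta'' 0 = \<delta> \<and>
     ints s ''v'' 0 = 0 \<and> ints s ''count'' 0 = 0 \<and> reals s ''bound'' 0 = 0 \<and>
     ints s ''k'' 0 = int k \<and> ints s ''i'' 0 = int (k div n) \<and> ints s ''j'' 0 = int (k mod n) \<and>
     ints s ''t'' 0 = int (k mod n * n + k div n) \<and>
     (\<forall>u<n. \<forall>v<n. ints s ''out'' (int (u * n + v)) = of_bool ((u, v) \<in> greedy G l h n k)) \<and>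
     (\<forall>v<n. ints s ''deg'' (int v) = deg (greedy G l h n k) v)"

definition count_invariant ::
  "nat \<Rightarrow> (nat \<times> nat) set \<Rightarrow> int \<Rightarrow> int \<Rightarrow> real \<Rightarrow> nat \<Rightarrow> store \<Rightarrow> bool" where
  "count_invariant n E l h \<delta> k s \<longleftrightarrow>
     ints s ''n'' 0 = int n \<and> ints s ''l'' 0 = l \<and> ints s ''h'' 0 = h \<and>
     reals s ''delta'' 0 = \<delta> \<and> ints s ''v'' 0 = int k \<and>
     ints s ''count'' 0 = int (card {v. v < k \<and> deg E v < l}) \<and>
     reals s ''bound'' 0 = \<delta> * real k \<and>
     (\<forall>u<n. \<forall>v<n. ints s ''out'' (int (u * n + v)) = of_bool ((u, v) \<in> E)) \<and>
     (\<forall>v<n. ints s ''deg'' (int v) = deg E v)"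

text \<open>Cells of \<open>''out''\<close> from \<open>k\<close> on are left open, since they may
  still hold matrix entries.\<close>

definition label_invariant ::
  "nat \<Rightarrow> (nat \<times> nat) set \<Rightarrow> int \<Rightarrow> int \<Rightarrow> nat \<Rightarrow> store \<Rightarrow> bool" where
  "label_invariant n E l h k s \<longleftrightarrow>
     ints s ''n'' 0 = int n \<and> ints s ''l'' 0 = l \<and> ints s ''h'' 0 = h \<and>
     ints s ''kind'' 0 = 2 \<and> ints s ''v'' 0 = int k \<and>
     (\<forall>v<k. ints s ''out'' (int v) = (if deg E v < l then 1 else if deg E v < h then 3 else 2)) \<and>
     (\<forall>v<n. ints s ''deg'' (int v) = deg E v)"

lemma scan_invariant_input_store:
  "scan_invariant n G l h \<delta> 0 (input_store n G l h \<delta>)"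
  by (simp add: scan_invariant_def input_store_def deg_def)

lemma scan_invariant_step:
  assumes G: "pair_graph G" and "1 \<le> l" "l \<le> h" and "k < n * n"
    and inv: "scan_invariant n G l h \<delta> k s"
  shows "scan_invariant n G l h \<delta> (Suc k) (result scan_body s)"
proof -
  interpret pair_graph G by (rule G)
  let ?i = "k div n" and ?j = "k mod n" and ?E = "greedy G l h n k"
  have "0 < n" using \<open>k < n * n\<close> by (cases n) auto
  then have ij: "?i < n" "?j < n"
    using \<open>k < n * n\<close> by (auto simp: less_mult_imp_div_less)
  have k: "k = ?i * n + ?j" by simp
  have E: "?E \<subseteq> parcs G" "sym ?E"
    using greedy_invariant_greedy[OF G \<open>1 \<le> l\<close> \<open>l \<le> h\<close>] by (auto simp: greedy_invariant_def)
  have graph: "adj_matrix n G (int k) = of_bool ((?i, ?j) \<in> parcs G)"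
    using adj_matrix_eq[OF ij, of G] by simp
  have out: "ints s ''out'' (int k) = of_bool ((?i, ?j) \<in> ?E)"
    using inv ij unfolding scan_invariant_def by (metis k)
  \<comment> \<open>Decides whether a matrix cell is one of the two that \<open>scan_pair\<close>
    may write.\<close>
  have index: "int (u * n + v) = int k \<longleftrightarrow> u = ?i \<and> v = ?j"
    "int (u * n + v) = int (?j * n + ?i) \<longleftrightarrow> u = ?j \<and> v = ?i" if "v < n" for u v
    unfolding of_nat_eq_iff using matrix_index_inject[of v n] that ij k by metis+
  let ?c = "(?i, ?j) \<in> parcs G \<and> (?i, ?j) \<notin> ?E \<and> deg ?E ?i < l \<and> deg ?E ?j < h"
  have deg: "deg (greedy G l h n (Suc k)) v = deg ?E v + of_bool (?c \<and> (v = ?i \<or> v = ?j))" for v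
    using E no_loops'[of ?i ?j] finite_subset[OF E(1) pair_finite_arcs]
    by (auto simp: add_edge_def deg_insert_edge)
  \<comment> \<open>The program tests \<open><\<close>, whereas wrap-around of the column is the
    equality \<open>Suc ?j = n\<close>.\<close>
  have "Suc ?j < n \<longleftrightarrow> Suc ?j \<noteq> n"
    using ij(2) by linarith
  then have succ: "Suc k div n = (if Suc ?j < n then ?i else Suc ?i)"
    "Suc k mod n = (if Suc ?j < n then Suc ?j else 0)"
    by (simp_all add: div_Suc mod_Suc)
  have mem: "(u, v) \<in> greedy G l h n (Suc k) \<longleftrightarrow>
      (u, v) \<in> ?E \<or> ?c \<and> (u = ?i \<and> v = ?j \<or> u = ?j \<and> v = ?i)" for u v
    by (auto simp: add_edge_def)
  have s: "ints s ''k'' 0 = int k" "ints s ''i'' 0 = int ?i" "ints s ''j'' 0 = int ?j"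
    "ints s ''t'' 0 = int (?j * n + ?i)" "ints s ''graph'' = adj_matrix n G"
    "ints s ''l'' 0 = l" "ints s ''h'' 0 = h" "ints s ''n'' 0 = int n"
    "ints s ''deg'' (int ?i) = deg ?E ?i" "ints s ''deg'' (int ?j) = deg ?E ?j"
    and out_s: "\<And>u v. u < n \<Longrightarrow> v < n \<Longrightarrow> ints s ''out'' (int (u * n + v)) = of_bool ((u, v) \<in> ?E)"
    and deg_s: "\<And>v. v < n \<Longrightarrow> ints s ''deg'' (int v) = deg ?E v"
    using inv ij unfolding scan_invariant_def by blast+
  define s' where "s' = result scan_pair s"
  \<comment> \<open>An arc is no loop, so \<open>?i\<close> and \<open>?j\<close> differ and the
    second increment still reads the old degree.\<close>
  have s'_eq: "s' = (if ?c then s\<lparr>ints := (ints s)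
      (''out'' := (ints s ''out'')(int k := 1, int (?j * n + ?i) := 1),
       ''deg'' := (ints s ''deg'')(int ?i := deg ?E ?i + 1, int ?j := deg ?E ?j + 1))\<rparr> else s)"
    using no_loops'[of ?i ?j]
    by (auto simp: s'_def scan_pair_def upd_def s graph out simp del: of_nat_add of_nat_mult)
  have s': "ints s' x = ints s x" if "x \<noteq> ''out''" "x \<noteq> ''deg''" for x
    using that by (simp add: s'_eq)
  have "reals s' = reals s"
    by (simp add: s'_eq)
  moreover have "ints s' ''out'' (int (u * n + v)) = of_bool ((u, v) \<in> greedy G l h n (Suc k))"
    if "u < n" "v < n" for u v
  proof -
    define a b where "a = int (u * n + v)" and "b = int (?j * n + ?i)"
    have "a = int k \<longleftrightarrow> u = ?i \<and> v = ?j" "a = b \<longleftrightarrow> u = ?j \<and> v = ?i"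
      "ints s ''out'' a = of_bool ((u, v) \<in> ?E)"
      unfolding a_def b_def using that index out_s by blast+
    moreover have "ints s' ''out'' a =
        (if ?c \<and> (a = int k \<or> a = b) then 1 else ints s ''out'' a)"
      unfolding s'_eq b_def[symmetric] by simp
    ultimately show ?thesis
      unfolding mem a_def[symmetric] by (simp only: of_bool_def if_distrib) argo
  qed
  moreover have "ints s' ''deg'' (int v) = deg (greedy G l h n (Suc k)) v" if "v < n" for v
    unfolding deg s'_eq using that by (cases ?c) (auto simp: deg_s)
  ultimately show ?thesis
    using inv
    by (simp add: scan_invariant_def scan_body_def next_pair_def upd_def s'_def[symmetric] s' succ distrib_right
        del: greedy.simps)
qed

lemma card_less_Suc_Collect:
  "card {v. v < Suc k \<and> P v} = card {v. v < k \<and> P v} + of_bool (P k)"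
proof -
  have "{v. v < Suc k \<and> P v} = (if P k then insert k else id) {v. v < k \<and> P v}"
    by (auto simp: less_Suc_eq)
  then show ?thesis by simp
qed

lemma count_invariant_step:
  assumes "k < n" "count_invariant n E l h \<delta> k s"
  shows "count_invariant n E l h \<delta> (Suc k) (result count_body s)"
  using assms unfolding count_invariant_def card_less_Suc_Collect
  by (auto simp: count_body_def upd_def distrib_left simp del: of_nat_add of_nat_mult)

lemma label_invariant_step:
  assumes "k < n" "label_invariant n E l h k s"
  shows "label_invariant n E l h (Suc k) (result label_body s)"
  using assms unfolding label_invariant_def
  by (auto simp: label_body_def upd_def less_Suc_eq)

section \<open>Complete loops and the format of the outputs\<close>

text \<open>The guard reads only the row number, which suffices because \<open>k div n < n\<close>
  holds exactly when \<open>k < n * n\<close>.\<close>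

lemma runs_scan:
  assumes "pair_graph G" "1 \<le> l" "l \<le> h" "scan_invariant n G l h \<delta> 0 s"
  shows "runs (While (Less (scalar ''i'') (scalar ''n'')) scan_body) s
    ((1 + bcost (Less (scalar ''i'') (scalar ''n'')) + cost scan_body) * Suc (n * n))
    (scan_invariant n G l h \<delta> (n * n))"
proof (rule runs_While)
  show "loop_free scan_body"
    by (simp add: scan_body_def scan_pair_def next_pair_def)
  show "bval (Less (scalar ''i'') (scalar ''n'')) s \<and>
      scan_invariant n G l h \<delta> (Suc k) (result scan_body s)"
    if "k < n * n" "scan_invariant n G l h \<delta> k s" for k s
    using scan_invariant_step[OF assms(1-3) that] that
    by (auto simp: scan_invariant_def less_mult_imp_div_less)
  \<comment> \<open>For \<open>n = 0\<close> the row number is \<open>0 div 0 = 0\<close>, so the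
    guard fails there too.\<close>
  show "\<not> bval (Less (scalar ''i'') (scalar ''n'')) s"
    if "scan_invariant n G l h \<delta> (n * n) s" for s
    using that by (cases "n = 0") (auto simp: scan_invariant_def)
qed (rule assms)

lemma runs_for_all_vertices:
  assumes "loop_free c" "I 0 s"
    and "\<And>k s. k < n \<Longrightarrow> I k s \<Longrightarrow> I (Suc k) (result c s)"
    and "\<And>k s. I k s \<Longrightarrow> ints s ''v'' 0 = int k \<and> ints s ''n'' 0 = int n"
  shows "runs (for_all_vertices c) s
    ((1 + bcost (Less (scalar ''v'') (scalar ''n'')) + cost c) * Suc n) (I n)"
  unfolding for_all_vertices_def using assms by (intro runs_While) auto

lemma outputs_graph_out:
  assumes "ints s ''kind'' 0 = 1"
    and "\<And>u v. u < n \<Longrightarrow> v < n \<Longrightarrow> ints s ''out'' (int (u * n + v)) = of_bool ((u, v) \<in> E)"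
  shows "outputs_graph s n \<lparr>pverts = V, parcs = E\<rparr>"
  unfolding outputs_graph_def
proof (intro conjI allI impI)
  fix k assume "k < n * n"
  then have "0 < n" by (cases n) auto
  then have ij: "k div n < n" "k mod n < n"
    using \<open>k < n * n\<close> by (auto simp: less_mult_imp_div_less)
  show "ints s ''out'' (int k) = adj_matrix n \<lparr>pverts = V, parcs = E\<rparr> (int k)"
    using assms(2)[OF ij] adj_matrix_eq[OF ij, of "\<lparr>pverts = V, parcs = E\<rparr>"] by simp
qed (rule assms(1))

text \<open>Label 2 means degree exactly \<open>h\<close> because no degree exceeds
  \<open>h\<close>.\<close>

lemma outputs_partition_label:
  assumes "label_invariant n E l h n s" "\<And>v. deg E v \<le> h" "l \<le> h"
  shows "outputs_partition s n {v. v < n \<and> deg E v < l} {v. v < n \<and> deg E v = h}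
    {v. v < n \<and> l \<le> deg E v \<and> deg E v < h}"
  using assms by (auto simp: outputs_partition_def label_invariant_def order_less_le)

section \<open>Correctness and running time of the whole algorithm\<close>

definition solved :: "nat \<Rightarrow> nat pair_pre_digraph \<Rightarrow> int \<Rightarrow> int \<Rightarrow> real \<Rightarrow> store \<Rightarrow> bool" where
  "solved n G l h \<delta> s \<longleftrightarrow>
     (\<exists>G'. outputs_graph s n G' \<and> degree_bounded_subgraph G l h \<delta> G') \<or>
     (\<exists>L H R. outputs_partition s n L H R \<and> low_degree_partition G l h \<delta> L H R)"

text \<open>Adds the costs per iteration of the three loops and the straight-line costs; the final 4
  pays for three \<open>Seq\<close> nodes and one \<open>Cond\<close> node.\<close>

definition time_factor :: nat where
  "time_factor =
     (1 + bcost (Less (scalar ''i'') (scalar ''n'')) + cost scan_body)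
     + (1 + bcost (Less (scalar ''v'') (scalar ''n'')) + cost count_body)
     + (1 + bcost (Less (scalar ''v'') (scalar ''n'')) + cost label_body)
     + bcost (RLess (OfInt (scalar ''count'')) (RCell ''bound'' (Const 0)))
     + cost (Seq (set_scalar ''kind'' (Const 2)) (set_scalar ''v'' (Const 0))) + 4"

text \<open>The left side has the shape that \<open>runs_Seq\<close> and \<open>runs_Cond\<close>
  produce for \<open>algorithm\<close>; both \<open>Suc n\<close> and \<open>Suc (n * n)\<close> are
  at most \<open>n * n + 4\<close>.\<close>

lemma linear_time_bound:
  fixes a :: nat
  shows "1 + a * Suc (n * n) + (1 + b * Suc n + (1 + d + (1 + e + c * Suc n)))
    \<le> (a + b + c + d + e + 4) * (n * n + 4)"
proof -
  have n: "Suc n \<le> n * n + 4" by (cases n) auto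
  have "a * Suc (n * n) \<le> a * (n * n + 4)" "b * Suc n \<le> b * (n * n + 4)" "c * Suc n \<le> c * (n * n + 4)"
    using n by (intro mult_le_mono2; simp)+
  moreover have "d + e + 4 \<le> (d + e + 4) * (n * n + 4)"
    by simp
  ultimately show ?thesis
    unfolding add_mult_distrib by linarith
qed

lemma runs_algorithm:
  assumes G: "pair_graph G" "pverts G = {..<n}" and lh: "1 \<le> l" "l \<le> h"
  shows "runs algorithm (input_store n G l h \<delta>) (time_factor * input_size n) (solved n G l h \<delta>)"
proof -
  let ?E = "greedy G l h n (n * n)"
  have inv: "greedy_invariant G l h ((\<lambda>k. (k div n, k mod n)) ` {..<n * n}) ?E"
    using greedy_invariant_greedy[OF G(1) lh] .
  have deg_le: "deg ?E v \<le> h" for v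
    using inv by (simp add: greedy_invariant_def)
  have graph: "solved n G l h \<delta> s"
    if "ints s ''kind'' 0 = 1" "real (card {v. v < n \<and> deg ?E v < l}) < \<delta> * real n"
      "\<And>u v. u < n \<Longrightarrow> v < n \<Longrightarrow> ints s ''out'' (int (u * n + v)) = of_bool ((u, v) \<in> ?E)" for s
    unfolding solved_def
    using outputs_graph_out[OF that(1,3)] degree_bounded_subgraph_greedy[OF G(1) inv] that(2) G(2)
    by auto
  have partition: "solved n G l h \<delta> s"
    if "label_invariant n ?E l h n s" "\<delta> * real n \<le> real (card {v. v < n \<and> deg ?E v < l})" for s
    unfolding solved_def
    using outputs_partition_label[OF that(1) deg_le lh(2)] that(2) G(2)
      low_degree_partition_greedy[OF G(1) lh inv parcs_subset_matrix_indices[OF G], of \<delta>]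
    by (intro disjI2 exI conjI) auto
  have count_0: "count_invariant n ?E l h \<delta> 0 s" if "scan_invariant n G l h \<delta> (n * n) s" for s
    using that by (simp add: scan_invariant_def count_invariant_def)
  let ?C = "\<lambda>c. 1 + bcost (Less (scalar ''v'') (scalar ''n'')) + cost c"
  let ?init = "Seq (set_scalar ''kind'' (Const 2)) (set_scalar ''v'' (Const 0))"
  have choose: "runs (Cond (RLess (OfInt (scalar ''count'')) (RCell ''bound'' (Const 0)))
        (set_scalar ''kind'' (Const 1)) (Seq ?init (for_all_vertices label_body))) s
      (1 + bcost (RLess (OfInt (scalar ''count'')) (RCell ''bound'' (Const 0)))
        + (1 + cost ?init + ?C label_body * Suc n))
      (solved n G l h \<delta>)" if count: "count_invariant n ?E l h \<delta> n s" for s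
  proof (rule runs_Cond)
    assume "bval (RLess (OfInt (scalar ''count'')) (RCell ''bound'' (Const 0))) s"
    then have "solved n G l h \<delta> (result (set_scalar ''kind'' (Const 1)) s)"
      using count by (intro graph) (auto simp: count_invariant_def upd_def simp del: of_nat_add of_nat_mult)
    then have "runs (set_scalar ''kind'' (Const 1)) s (cost (set_scalar ''kind'' (Const 1))) (solved n G l h \<delta>)"
      by (intro runs_loop_free) auto
    \<comment> \<open>The short branch is charged the time of the labelling branch, since
      \<open>runs_Cond\<close> expects a common bound.\<close>
    then show "runs (set_scalar ''kind'' (Const 1)) s
        (1 + cost ?init + ?C label_body * Suc n) (solved n G l h \<delta>)"
      by (rule runs_mono) auto
  next
    assume "\<not> bval (RLess (OfInt (scalar ''count'')) (RCell ''bound'' (Const 0))) s"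
    then have "\<delta> * real n \<le> real (card {v. v < n \<and> deg ?E v < l})"
      using count by (simp add: count_invariant_def)
    note partition = partition[OF _ this]
    show "runs (Seq ?init (for_all_vertices label_body)) s
        (1 + cost ?init + ?C label_body * Suc n) (solved n G l h \<delta>)"
    proof (rule runs_Seq)
      show "runs ?init s (cost ?init) (label_invariant n ?E l h 0)"
        using count by (intro runs_loop_free) (auto simp: label_invariant_def count_invariant_def upd_def)
      show "runs (for_all_vertices label_body) s' (?C label_body * Suc n) (solved n G l h \<delta>)"
        if "label_invariant n ?E l h 0 s'" for s'
        using that
        by (intro runs_mono[OF runs_for_all_vertices[of _ "label_invariant n ?E l h"] order_refl partition]
            label_invariant_step) (auto simp: label_body_def label_invariant_def)
    qed
  qed
  show ?thesis
    unfolding algorithm_def time_factor_def input_size_def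
  proof (rule runs_mono[OF _ linear_time_bound])
    show "runs (Seq (While (Less (scalar ''i'') (scalar ''n'')) scan_body)
       (Seq (for_all_vertices count_body)
        (Cond (RLess (OfInt (scalar ''count'')) (RCell ''bound'' (Const 0)))
          (set_scalar ''kind'' (Const 1))
          (Seq ?init (for_all_vertices label_body)))))
      (input_store n G l h \<delta>)
      (1 + (1 + bcost (Less (scalar ''i'') (scalar ''n'')) + cost scan_body) * Suc (n * n)
        + (1 + ?C count_body * Suc n
        + (1 + bcost (RLess (OfInt (scalar ''count'')) (RCell ''bound'' (Const 0)))
        + (1 + cost ?init + ?C label_body * Suc n))))
      (solved n G l h \<delta>)"
    proof (rule runs_Seq[OF runs_scan[OF G(1) lh scan_invariant_input_store] runs_Seq[OF _ choose]])
      show "runs (for_all_vertices count_body) s (?C count_body * Suc n)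
          (count_invariant n ?E l h \<delta> n)" if "scan_invariant n G l h \<delta> (n * n) s" for s
        using count_0[OF that]
        by (intro runs_for_all_vertices[where I = "count_invariant n ?E l h \<delta>"] count_invariant_step)
          (auto simp: count_body_def count_invariant_def)
    qed
  qed
qed

theorem lemma4:
  shows "\<exists>(prog :: com) (p :: nat poly).
    \<forall>(n :: nat) (G :: nat pair_pre_digraph) (l :: int) (h :: int) (\<delta> :: real).
      pair_graph G \<and> pverts G = {..<n} \<and> 1 \<le> l \<and> l \<le> h \<and> 0 \<le> \<delta> \<and> \<delta> \<le> 1 \<longrightarrow>
      (\<exists>t s. exec prog (input_store n G l h \<delta>) t s \<and> t \<le> poly p (input_size n) \<and>
        ((\<exists>G'. outputs_graph s n G' \<and> degree_bounded_subgraph G l h \<delta> G') \<or>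
         (\<exists>L H R. outputs_partition s n L H R \<and> low_degree_partition G l h \<delta> L H R)))"
\<comment> \<open>The polynomial is \<open>time_factor * x\<close>: the time is linear in the size
  of the matrix input.\<close>
proof (intro exI[of _ algorithm] exI[of _ "[:0, time_factor:]"] allI impI, elim conjE)
  fix n :: nat and G :: "nat pair_pre_digraph" and l h :: int and \<delta> :: real
  assume "pair_graph G" "pverts G = {..<n}" "1 \<le> l" "l \<le> h"
  from runs_algorithm[OF this, of \<delta>]
  show "\<exists>t s. exec algorithm (input_store n G l h \<delta>) t s \<and>
      t \<le> poly [:0, time_factor:] (input_size n) \<and>
      ((\<exists>G'. outputs_graph s n G' \<and> degree_bounded_subgraph G l h \<delta> G') \<or>
       (\<exists>L H R. outputs_partition s n L H R \<and> low_degree_partition G l h \<delta> L H R))"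
    by (simp add: runs_def solved_def mult.commute)
qed

end
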